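(* There exists a universal constant $c>0$ such that for every probability value $p_b\in[0,1)$ there exist an autoregressive model $L$ and a candidate set $\mathcal S$ with $p_b = 1-P_L(\mathcal S)$ such that $$\mathrm{KL}\big(P_{\mathcal S}\,\|\,P^{\mathrm{CD}}_{\mathcal S}\big)\;\ge\; c\,\ln\frac{1}{1-p_b},$$ where $P_{\mathcal S}$ is the model distribution conditioned on $\mathcal S$ and $P^{\mathrm{CD}}_{\mathcal S}$ is the output distribution of constrained decoding.
   Context: Let $\mathcal V$ be a finite vocabulary (token set), which may be chosen freely together with the model. Sequences are finite sequences of tokens $\boldsymbol x=[x_1,\dots,x_T]$; write $\boldsymbol x_{<t}=[x_1,\dots,x_{t-1}]$, write $\boldsymbol x+\boldsymbol y$ for concatenation, and write $\boldsymbol y\preceq\boldsymbol x$ if $\boldsymbol y$ is a prefix (initial segment, possibly all) of $\boldsymbol x$. An autoregressive model $L$ assigns to each token sequence $\boldsymbol y$ a next-token probability distribution $P_L(\cdot\mid\boldsymbol y)$ on $\mathcal V$, and gives a sequence $\boldsymbol x$ of length $T$ the probability $P_L(\boldsymbol x)=\prod_{t=1}^T P_L(x_t\mid\boldsymbol x_{<t})$. For a set $B\subseteq\mathcal V$, $P_L(B\mid\boldsymbol y)=\sum_{v\in B}P_L(v\mid\boldsymbol y)$. Complete sequences are terminated by a special end-of-keyword token, regarded as the last token of the sequence and appearing nowhere else; so no sequence of a candidate set is a proper prefix of another. A candidate (constraint) set $\mathcal S$ is a finite nonempty set of complete sequences, and $P_L(\mathcal S)=\sum_{\boldsymbol s\in\mathcal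 S}P_L(\boldsymbol s)$. Thus $p_b=1-P_L(\mathcal S)$ is the probability mass the model assigns outside $\mathcal S$. The target distribution is $P_{\mathcal S}(\boldsymbol s)=P_L(\boldsymbol s)/P_L(\mathcal S)$ for $\boldsymbol s\in\mathcal S$. For a sequence $\boldsymbol x$, the set of valid next tokens is $\mathcal A_{\boldsymbol x,\mathcal S}=\{v\in\mathcal V:\exists\,\boldsymbol s\in\mathcal S,\ \boldsymbol x+[v]\preceq\boldsymbol s\}$. Constrained decoding starts from the empty sequence and, at each step with current prefix $\boldsymbol x$, samples the next token from $P_L(\cdot\mid\boldsymbol x)$ restricted to $\mathcal A_{\boldsymbol x,\mathcal S}$ and renormalized, until an element of $\mathcal S$ is produced (it is required that the normalizing mass $P_L(\mathcal A_{\boldsymbol x,\mathcal S}\mid\boldsymbol x)$ be positive at every reachable prefix). Its output distribution is $$P^{\mathrm{CD}}_{\mathcal S}(\boldsymbol s)=\prod_{t=1}^{|\boldsymbol s|}\frac{P_L(s_t\mid\boldsymbol s_{<t})}{P_L(\mathcal A_{\boldsymbol s_{<t},\mathcal S}\mid\boldsymbol s_{<t})},\qquad \boldsymbol s\in\mathcal S.$$ For discrete distributions $P,Q$ on a set $\mathcal X$, $\mathrm{KL}(P\|Q)=\sum_{x\in\mathcal X}P(x)\ln\frac{P(x)}{Q(x)}$ (with $0\ln 0=0$). *)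

theory Defs
  imports "HOL-Probability.Probability" "HOL-Library.Sublist"
begin

(* The vocabulary is a finite set V of tokens of an arbitrary type. The values of L on lists
   with entries outside V are irrelevant. *)
definition autoregressive_model :: "'a set \<Rightarrow> ('a list \<Rightarrow> 'a pmf) \<Rightarrow> bool" where
  "autoregressive_model V L \<longleftrightarrow> finite V \<and> (\<forall>y\<in>lists V. set_pmf (L y) \<subseteq> V)"

definition seq_prob :: "('a list \<Rightarrow> 'a pmf) \<Rightarrow> 'a list \<Rightarrow> real" where
  "seq_prob L x = (\<Prod>t<length x. pmf (L (take t x)) (x ! t))"

(* e is the end-of-keyword token; it is itself an element of the vocabulary. *)
definition complete_seqs :: "'a set \<Rightarrow> 'a \<Rightarrow> 'a list set" where
  "complete_seqs V e = {w @ [e] | w. w \<in> lists (V - {e})}"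

definition candidate_set :: "'a set \<Rightarrow> 'a \<Rightarrow> 'a list set \<Rightarrow> bool" where
  "candidate_set V e S \<longleftrightarrow> e \<in> V \<and> finite S \<and> S \<noteq> {} \<and> S \<subseteq> complete_seqs V e"

definition set_prob :: "('a list \<Rightarrow> 'a pmf) \<Rightarrow> 'a list set \<Rightarrow> real" where
  "set_prob L S = (\<Sum>s\<in>S. seq_prob L s)"

definition target_prob :: "('a list \<Rightarrow> 'a pmf) \<Rightarrow> 'a list set \<Rightarrow> 'a list \<Rightarrow> real" where
  "target_prob L S s = seq_prob L s / set_prob L S"

definition valid_next :: "'a set \<Rightarrow> 'a list set \<Rightarrow> 'a list \<Rightarrow> 'a set" where
  "valid_next V S x = {v \<in> V. \<exists>s\<in>S. prefix (x @ [v]) s}"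

definition valid_mass :: "'a set \<Rightarrow> ('a list \<Rightarrow> 'a pmf) \<Rightarrow> 'a list set \<Rightarrow> 'a list \<Rightarrow> real" where
  "valid_mass V L S x = measure_pmf.prob (L x) (valid_next V S x)"

(* Prefixes that constrained decoding visits with positive probability. *)
inductive_set cd_reachable :: "'a set \<Rightarrow> ('a list \<Rightarrow> 'a pmf) \<Rightarrow> 'a list set \<Rightarrow> 'a list set"
  for V :: "'a set" and L :: "'a list \<Rightarrow> 'a pmf" and S :: "'a list set" where
  start: "[] \<in> cd_reachable V L S"
| step: "x \<in> cd_reachable V L S \<Longrightarrow> x \<notin> S \<Longrightarrow> v \<in> set_pmf (L x) \<Longrightarrow> v \<in> valid_next V S x
          \<Longrightarrow> x @ [v] \<in> cd_reachable V L S"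

(* Decoding stops on reaching an element of S, so nothing is required there. *)
definition cd_well_defined :: "'a set \<Rightarrow> ('a list \<Rightarrow> 'a pmf) \<Rightarrow> 'a list set \<Rightarrow> bool" where
  "cd_well_defined V L S \<longleftrightarrow> (\<forall>x\<in>cd_reachable V L S. x \<notin> S \<longrightarrow> valid_mass V L S x > 0)"

(* If cd_well_defined holds, a factor with zero denominator can occur only behind a factor with
   zero numerator, so the convention x / 0 = 0 does not affect the product. *)
definition cd_prob :: "'a set \<Rightarrow> ('a list \<Rightarrow> 'a pmf) \<Rightarrow> 'a list set \<Rightarrow> 'a list \<Rightarrow> real" where
  "cd_prob V L S s =
    (\<Prod>t<length s. pmf (L (take t s)) (s ! t) / valid_mass V L S (take t s))"

(* Real-valued, hence meaningful only if Q x = 0 implies P x = 0. This holds for P = target_prob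
   and Q = cd_prob: each valid_mass is at most 1, and is positive wherever the next token of s
   has positive probability, so cd_prob V L S s \<ge> seq_prob L s for s in S. *)
definition kl_div :: "'b set \<Rightarrow> ('b \<Rightarrow> real) \<Rightarrow> ('b \<Rightarrow> real) \<Rightarrow> real" where
  "kl_div X P Q = (\<Sum>x\<in>X. P x * ln (P x / Q x))"

end

theory Submission
  imports Defs
begin

text \<open>
  Write \<open>q = 1 - p_b\<close>. Over the tokens \<open>{0, 1}\<close>, with end token \<open>0\<close>, take \<open>S = {[0], [1, 0]}\<close>, and let
  the model emit \<open>0\<close> with probability \<open>\<alpha>\<close> at the start and with probability \<open>\<beta>\<close> after \<open>[1]\<close>.
  Constrained decoding then outputs \<open>[0]\<close> and \<open>[1, 0]\<close> with probabilities \<open>\<alpha>\<close> and \<open>1 - \<alpha>\<close>, whereas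
  the target puts mass \<open>\<alpha> / q\<close> on \<open>[0]\<close>. If this mass is \<open>1 - (1 - q) / 15\<close>, then \<open>[0]\<close> contributes
  at least \<open>14/15 ln (1/q)\<close> to the divergence, while \<open>[1, 0]\<close> costs only
  \<open>(1 - q) / 15 ln (15 + q) \<le> 4/15 (1 - q) \<le> 4/15 ln (1/q)\<close>.
\<close>

definition two_step_model :: "real \<Rightarrow> real \<Rightarrow> nat list \<Rightarrow> nat pmf" where
  "two_step_model \<alpha> \<beta> y =
     map_pmf (\<lambda>b. if b then 0 else 1) (bernoulli_pmf (if y = [] then \<alpha> else \<beta>))"

definition two_step_set :: "nat list set" where
  "two_step_set = {[0], [1, 0]}"

lemma set_pmf_two_step_model: "set_pmf (two_step_model \<alpha> \<beta> y) \<subseteq> {0, 1}"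
  by (auto simp: two_step_model_def)

lemma pmf_two_step_model:
  assumes "0 \<le> \<alpha>" "\<alpha> \<le> 1" "0 \<le> \<beta>" "\<beta> \<le> 1"
  shows "pmf (two_step_model \<alpha> \<beta> y) 0 = (if y = [] then \<alpha> else \<beta>)"
    and "pmf (two_step_model \<alpha> \<beta> y) 1 = (if y = [] then 1 - \<alpha> else 1 - \<beta>)"
proof -
  let ?f = "\<lambda>b. if b then 0 else 1 :: nat"
  have "inj ?f"
    by (auto simp: inj_def)
  from pmf_map_inj'[OF this, of _ True] pmf_map_inj'[OF this, of _ False] assms
  show "pmf (two_step_model \<alpha> \<beta> y) 0 = (if y = [] then \<alpha> else \<beta>)"
    and "pmf (two_step_model \<alpha> \<beta> y) 1 = (if y = [] then 1 - \<alpha> else 1 - \<beta>)"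
    by (auto simp: two_step_model_def)
qed

lemma valid_next_two_step:
  "valid_next {0, 1} two_step_set [] = {0, 1}"
  "valid_next {0, 1} two_step_set [1] = {0}"
  by (auto simp: valid_next_def two_step_set_def)

lemma valid_mass_two_step:
  assumes "0 \<le> \<alpha>" "\<alpha> \<le> 1" "0 \<le> \<beta>" "\<beta> \<le> 1"
  shows "valid_mass {0, 1} (two_step_model \<alpha> \<beta>) two_step_set [] = 1"
    and "valid_mass {0, 1} (two_step_model \<alpha> \<beta>) two_step_set [1] = \<beta>"
  using assms pmf_two_step_model[OF assms]
  unfolding valid_mass_def valid_next_two_step
  by (simp_all add: measure_measure_pmf_finite)

lemma seq_prob_two_step:
  assumes "0 \<le> \<alpha>" "\<alpha> \<le> 1" "0 \<le> \<beta>" "\<beta> \<le> 1"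
  shows "seq_prob (two_step_model \<alpha> \<beta>) [0] = \<alpha>"
    and "seq_prob (two_step_model \<alpha> \<beta>) [1, 0] = (1 - \<alpha>) * \<beta>"
  using pmf_two_step_model[OF assms] by (simp_all add: seq_prob_def)

lemma set_prob_two_step:
  assumes "0 \<le> \<alpha>" "\<alpha> \<le> 1" "0 \<le> \<beta>" "\<beta> \<le> 1"
  shows "set_prob (two_step_model \<alpha> \<beta>) two_step_set = \<alpha> + (1 - \<alpha>) * \<beta>"
  using seq_prob_two_step[OF assms] by (simp add: set_prob_def two_step_set_def)

text \<open>Both tokens are valid at the start, so renormalization can only alter the step after
  \<open>[1]\<close>: there the factor \<open>\<beta>\<close> becomes
  \<open>\<beta> / \<beta>\<close>, which is 1 because \<open>\<beta>\<close> is positive.\<close>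

lemma cd_prob_two_step:
  assumes "0 \<le> \<alpha>" "\<alpha> \<le> 1" "0 < \<beta>" "\<beta> \<le> 1"
  shows "cd_prob {0, 1} (two_step_model \<alpha> \<beta>) two_step_set [0] = \<alpha>"
    and "cd_prob {0, 1} (two_step_model \<alpha> \<beta>) two_step_set [1, 0] = 1 - \<alpha>"
  using assms pmf_two_step_model[of \<alpha> \<beta>] valid_mass_two_step[of \<alpha> \<beta>]
  by (simp_all add: cd_prob_def)

text \<open>An over-approximation valid for every \<open>L\<close> is enough: outside
  \<open>two_step_set\<close> it leaves only \<open>[]\<close> and \<open>[1]\<close>, whose valid
  masses are known.\<close>

lemma cd_reachable_two_step:
  assumes "x \<in> cd_reachable {0, 1} L two_step_set"
  shows "x \<in> {[], [1]} \<union> two_step_set"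
  using assms
  by induction (auto simp: valid_next_def two_step_set_def)

lemma cd_well_defined_two_step:
  assumes "0 \<le> \<alpha>" "\<alpha> \<le> 1" "0 < \<beta>" "\<beta> \<le> 1"
  shows "cd_well_defined {0, 1} (two_step_model \<alpha> \<beta>) two_step_set"
  using assms cd_reachable_two_step valid_mass_two_step[of \<alpha> \<beta>]
  unfolding cd_well_defined_def by fastforce

lemma candidate_set_two_step: "candidate_set {0, 1} 0 two_step_set"
proof -
  have "w @ [0] \<in> complete_seqs {0, 1} (0::nat)" if "w \<in> {[], [1]}" for w
    using that by (auto simp: complete_seqs_def)
  from this[of "[]"] this[of "[1]"] show ?thesis
    by (simp add: candidate_set_def two_step_set_def)
qed

lemma kl_div_two_step:
  assumes "0 < \<alpha>" "\<alpha> \<le> 1" "0 < \<beta>" "\<beta> \<le> 1"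
    and q: "q = \<alpha> + (1 - \<alpha>) * \<beta>"
  shows "kl_div two_step_set (target_prob (two_step_model \<alpha> \<beta>) two_step_set)
      (cd_prob {0, 1} (two_step_model \<alpha> \<beta>) two_step_set)
    = \<alpha> / q * ln (1 / q) + (1 - \<alpha>) * \<beta> / q * ln (\<beta> / q)"
  using assms seq_prob_two_step[of \<alpha> \<beta>] set_prob_two_step[of \<alpha> \<beta>] cd_prob_two_step[of \<alpha> \<beta>]
  \<comment> \<open>For \<open>\<alpha> = 1\<close> the factor \<open>1 - \<alpha>\<close> cannot be
    cancelled from the ratio on \<open>[1, 0]\<close>, but that term then has weight 0 on both
    sides.\<close>
  by (cases "\<alpha> = 1") (simp_all add: kl_div_def target_prob_def two_step_set_def)

lemma two_step_bound:
  fixes q :: real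
  assumes "0 < q" "q \<le> 1"
  shows "(14 + q) / 15 * ln (1 / q) + (1 - q) / 15 * ln (1 / (15 + q)) \<ge> 2 / 3 * ln (1 / q)"
proof -
  have lnq: "1 - q \<le> ln (1 / q)"
    using ln_le_minus_one[of q] assms by (simp add: ln_div)
  \<comment> \<open>The argument is at most 16, and \<open>ln 2 \<le> 1\<close> then gives the bound
    4.\<close>
  have "ln (15 + q) \<le> ln (2 ^ 4)"
    using assms by simp
  also have "\<dots> \<le> 4"
    using ln_le_minus_one[of 2] by (simp only: ln_realpow) simp
  finally have "ln (1 / (15 + q)) \<ge> -4"
    using assms by (simp add: ln_div)
  then have "(1 - q) / 15 * ln (1 / (15 + q)) \<ge> (1 - q) / 15 * -4"
    using assms by (intro mult_left_mono) auto
  \<comment> \<open>By \<open>lnq\<close> the logarithm is nonnegative, so the coefficient may be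
    lowered.\<close>
  moreover have "(14 + q) / 15 * ln (1 / q) \<ge> 14 / 15 * ln (1 / q)"
    using assms lnq by (intro mult_right_mono) auto
  ultimately show ?thesis
    using lnq by argo
qed

theorem theorem2p1:
  "\<exists>c::real. c > 0 \<and>
     (\<forall>p_b::real. 0 \<le> p_b \<and> p_b < 1 \<longrightarrow>
       (\<exists>(V :: nat set) (e :: nat) (L :: nat list \<Rightarrow> nat pmf) (S :: nat list set).
          autoregressive_model V L \<and> candidate_set V e S \<and> cd_well_defined V L S \<and>
          p_b = 1 - set_prob L S \<and>
          kl_div S (target_prob L S) (cd_prob V L S) \<ge> c * ln (1 / (1 - p_b))))"
proof (intro exI[of _ "2 / 3"] conjI allI impI)
  fix p_b :: real
  assume p_b: "0 \<le> p_b \<and> p_b < 1"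
  define q where "q = 1 - p_b"
  \<comment> \<open>\<open>\<alpha>\<close> is \<open>q\<close> times the desired target mass
    \<open>1 - (1 - q) / 15\<close> of \<open>[0]\<close>. \<open>\<beta>\<close> comes from solving
    \<open>\<alpha> + (1 - \<alpha>) * \<beta> = q\<close>; the common factor \<open>1 - q\<close>
    is cancelled, so \<open>q = 1\<close> needs no separate case.\<close>
  define \<alpha> where "\<alpha> = q * (14 + q) / 15"
  define \<beta> where "\<beta> = q / (15 + q)"
  have q: "0 < q" "q \<le> 1"
    using p_b by (auto simp: q_def)
  \<comment> \<open>This factorization shows the sign of \<open>1 - \<alpha>\<close> and exposes the
    factor \<open>15 + q\<close> that cancels the denominator of \<open>\<beta>\<close>.\<close>
  have compl: "1 - \<alpha> = (1 - q) * (15 + q) / 15"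
    by (simp add: \<alpha>_def algebra_simps)
  have "0 \<le> 1 - \<alpha>"
    unfolding compl using q by simp
  then have \<alpha>: "0 < \<alpha>" "\<alpha> \<le> 1"
    using q by (auto simp: \<alpha>_def)
  have \<beta>: "0 < \<beta>" "\<beta> \<le> 1"
    using q by (auto simp: \<beta>_def)
  have tail: "(1 - \<alpha>) * \<beta> = q * ((1 - q) / 15)"
    unfolding compl using q by (simp add: \<beta>_def divide_simps)
  have mass: "q = \<alpha> + (1 - \<alpha>) * \<beta>"
    unfolding tail by (simp add: \<alpha>_def field_simps)
  have ratios: "\<alpha> / q = (14 + q) / 15" "(1 - \<alpha>) * \<beta> / q = (1 - q) / 15" "\<beta> / q = 1 / (15 + q)"
    unfolding tail using q by (simp_all add: \<alpha>_def \<beta>_def)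
  let ?L = "two_step_model \<alpha> \<beta>"
  have "autoregressive_model {0, 1} ?L"
    using set_pmf_two_step_model by (simp add: autoregressive_model_def)
  moreover have "cd_well_defined {0, 1} ?L two_step_set"
    using \<alpha> \<beta> by (intro cd_well_defined_two_step) auto
  moreover have "p_b = 1 - set_prob ?L two_step_set"
    using \<alpha> \<beta> mass by (simp add: set_prob_two_step q_def)
  moreover have "kl_div two_step_set (target_prob ?L two_step_set)
      (cd_prob {0, 1} ?L two_step_set) \<ge> 2 / 3 * ln (1 / (1 - p_b))"
    using two_step_bound[OF q] unfolding kl_div_two_step[OF \<alpha> \<beta> mass] ratios
    by (simp add: q_def)
  ultimately show "\<exists>(V :: nat set) (e :: nat) (L :: nat list \<Rightarrow> nat pmf) (S :: nat list set).
      autoregressive_model V L \<and> candidate_set V e S \<and> cd_well_defined V L S \<and>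
      p_b = 1 - set_prob L S \<and>
      kl_div S (target_prob L S) (cd_prob V L S) \<ge> 2 / 3 * ln (1 / (1 - p_b))"
    using candidate_set_two_step by blast
qed simp

end
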